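(* Let $A\in\mathbb{R}^{n\times n}$ be symmetric positive semidefinite, let $p\ge1$, and let $X_M=\left(\frac1M\sum_{j=1}^M w_j^TA^pw_j\right)^{1/p}$ with $w_1,\dots,w_M$ independent standard Gaussian random vectors in $\mathbb{R}^n$. Then for all $M\ge1$, $$\mathbb{E}(X_M)\le\|A\|_{S_p}.$$
   Context: For a symmetric positive semidefinite matrix $A\in\mathbb{R}^{n\times n}$ with eigenvalues $\lambda_1,\dots,\lambda_n\ge 0$ and $p\ge1$, the Schatten $p$-norm is $\|A\|_{S_p}=\big(\sum_{j=1}^n\lambda_j^p\big)^{1/p}=(\operatorname{tr}(A^p))^{1/p}$, where $A^p$ is defined through the spectral decomposition. The samples $w_j:\Omega\to\mathbb{R}^n$ are independent random vectors on a probability space $(\Omega,\mathcal{F},\mathbb{P})$ whose entries are independent standard normal random variables. *)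

theory Defs
  imports
    "HOL-Probability.Probability"
    "HOL-Computational_Algebra.Computational_Algebra"
begin

definition positive_semidefinite :: "real^'n^'n \<Rightarrow> bool" where
  "positive_semidefinite A \<longleftrightarrow> transpose A = A \<and> (\<forall>x. 0 \<le> x \<bullet> (A *v x))"

definition diagonal_matrix :: "('n \<Rightarrow> real) \<Rightarrow> real^'n^'n" where
  "diagonal_matrix d = (\<chi> i j. if i = j then d i else 0)"

definition spectral_decomposition :: "real^'n^'n \<Rightarrow> real^'n^'n \<Rightarrow> ('n \<Rightarrow> real) \<Rightarrow> bool" where
  "spectral_decomposition A Q d \<longleftrightarrow>
     orthogonal_matrix Q \<and> A = Q ** diagonal_matrix d ** transpose Q"

text \<open>The value below does not depend on the decomposition
  (see \<open>matrix_powr_eq\<close>), so the description is proper whenever \<open>A\<close> has one,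
  i.e. whenever \<open>A\<close> is symmetric. The real power satisfies \<open>0 powr p = 0\<close>, which is the
  intended value for \<open>p > 0\<close>.\<close>

definition matrix_powr :: "real^'n^'n \<Rightarrow> real \<Rightarrow> real^'n^'n" where
  "matrix_powr A p =
     (THE B. \<exists>Q d. spectral_decomposition A Q d \<and>
        B = Q ** diagonal_matrix (\<lambda>i. d i powr p) ** transpose Q)"

lemma spectral_decomposition_fun_unique:
  assumes "spectral_decomposition A Q d" and "spectral_decomposition A R e"
  shows "Q ** diagonal_matrix (\<lambda>i. f (d i)) ** transpose Q =
         R ** diagonal_matrix (\<lambda>i. f (e i)) ** transpose R"
proof -
  have Q: "transpose Q ** Q = mat 1" "Q ** transpose Q = mat 1"
    and R: "transpose R ** R = mat 1" "R ** transpose R = mat 1"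
    using assms by (auto simp: spectral_decomposition_def orthogonal_matrix_def)
  define U where "U = transpose R ** Q"
  have left: "(U ** diagonal_matrix g) $ i $ j = U $ i $ j * g j" for g i j
    by (simp add: matrix_matrix_mult_def diagonal_matrix_def if_distrib cong: if_cong)
  have right: "(diagonal_matrix g ** U) $ i $ j = g i * U $ i $ j" for g i j
    by (simp add: matrix_matrix_mult_def diagonal_matrix_def if_distribR if_distrib cong: if_cong)
  have eq: "Q ** diagonal_matrix d ** transpose Q = R ** diagonal_matrix e ** transpose R"
    using assms by (simp add: spectral_decomposition_def)
  have "U ** diagonal_matrix d =
      transpose R ** (Q ** diagonal_matrix d ** transpose Q) ** Q"
    by (simp add: U_def matrix_mul_assoc [symmetric] Q)
  also have "\<dots> = diagonal_matrix e ** U"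
    unfolding eq U_def by (simp add: matrix_mul_assoc R)
  finally have comm: "U $ i $ j * d j = e i * U $ i $ j" for i j
    using left right by metis
  have "U $ i $ j * f (d j) = f (e i) * U $ i $ j" for i j
    using comm [of i j] by (cases "U $ i $ j = 0") auto
  then have UD: "U ** diagonal_matrix (\<lambda>i. f (d i)) = diagonal_matrix (\<lambda>i. f (e i)) ** U"
    by (simp add: vec_eq_iff left right)
  have "Q ** diagonal_matrix (\<lambda>i. f (d i)) ** transpose Q =
      R ** (U ** diagonal_matrix (\<lambda>i. f (d i))) ** transpose Q"
    by (simp add: U_def matrix_mul_assoc R)
  also have "\<dots> = R ** diagonal_matrix (\<lambda>i. f (e i)) ** transpose R"
    unfolding UD by (simp add: U_def matrix_mul_assoc [symmetric] Q)
  finally show ?thesis .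
qed

lemma matrix_powr_eq:
  assumes "spectral_decomposition A Q d"
  shows "matrix_powr A p = Q ** diagonal_matrix (\<lambda>i. d i powr p) ** transpose Q"
  unfolding matrix_powr_def
proof (rule the_equality)
  fix B
  assume "\<exists>Q d. spectral_decomposition A Q d \<and>
    B = Q ** diagonal_matrix (\<lambda>i. d i powr p) ** transpose Q"
  then show "B = Q ** diagonal_matrix (\<lambda>i. d i powr p) ** transpose Q"
    using spectral_decomposition_fun_unique [OF _ assms, of _ _ "\<lambda>x. x powr p"] by blast
qed (use assms in blast)

definition characteristic_poly :: "real^'n^'n \<Rightarrow> real poly" where
  "characteristic_poly A = det (\<chi> i j. [:- (A $ i $ j), if i = j then 1 else 0:])"

text \<open>The multiset of real eigenvalues, with algebraic multiplicity; for symmetric matrices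
  it has as many elements as the dimension.\<close>

definition eigenvalues :: "real^'n^'n \<Rightarrow> real multiset" where
  "eigenvalues A = proots (characteristic_poly A)"

definition schatten_norm :: "real \<Rightarrow> real^'n^'n \<Rightarrow> real" where
  "schatten_norm p A = (\<Sum>l\<in>#eigenvalues A. l powr p) powr (1 / p)"

definition (in prob_space) standard_gaussian_vector :: "('a \<Rightarrow> real^'n) \<Rightarrow> bool" where
  "standard_gaussian_vector w \<longleftrightarrow>
     indep_vars (\<lambda>_. borel) (\<lambda>i \<omega>. w \<omega> $ i) UNIV \<and>
     (\<forall>i. distributed M lborel (\<lambda>\<omega>. w \<omega> $ i) std_normal_density)"

definition schatten_estimator ::
    "real \<Rightarrow> real^'n^'n \<Rightarrow> (nat \<Rightarrow> 'a \<Rightarrow> real^'n) \<Rightarrow> nat \<Rightarrow> 'a \<Rightarrow> real" where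
  "schatten_estimator p A w M \<omega> =
     (1 / real M * (\<Sum>j=1..M. w j \<omega> \<bullet> (matrix_powr A p *v w j \<omega>))) powr (1 / p)"

end

theory Submission
  imports Defs
begin

unbundle no fps_syntax

text \<open>With \<open>A = Q D Q\<^sup>T\<close> from the spectral theorem, the trace of \<open>A\<^sup>p\<close> is the sum of the
  \<open>p\<close>-th powers of the eigenvalues. As the entries of \<open>w\<close> are uncorrelated with unit variance, it is
  also the expectation of \<open>w\<^sup>T A\<^sup>p w\<close>, hence of the \<open>p\<close>-th power of the estimator. Concavity of
  \<open>x \<mapsto> x powr (1 / p)\<close> (Jensen's inequality) then gives the bound.\<close>

section \<open>The spectral theorem for symmetric matrices\<close>

text \<open>Supplies one eigenvector for the spectral theorem. At a maximizer of the form on the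
  unit sphere of \<open>S\<close>, the residual \<open>g\<close> must vanish: invariance puts it in
  \<open>S\<close>, and otherwise a small move along it would contradict maximality.\<close>

lemma form_maximizer_is_eigenvector:
  fixes f :: "'a::euclidean_space \<Rightarrow> 'a"
  assumes lin: "linear f" and selfadj: "\<And>x y. f x \<bullet> y = x \<bullet> f y"
    and S: "subspace S" and inv: "\<And>x. x \<in> S \<Longrightarrow> f x \<in> S"
    and v: "v \<in> S" "norm v = 1"
    and max: "\<And>x. x \<in> S \<Longrightarrow> norm x = 1 \<Longrightarrow> x \<bullet> f x \<le> v \<bullet> f v"
  shows "f v = (v \<bullet> f v) *\<^sub>R v"
proof -
  define m where "m = v \<bullet> f v"
  define g where "g = m *\<^sub>R v - f v"
  define q where "q x = m * (x \<bullet> x) - x \<bullet> f x" for x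
  have vv: "v \<bullet> v = 1"
    using v by (simp add: norm_eq_1)
  have q_nonneg: "0 \<le> q x" if "x \<in> S" for x
  proof (cases "x = 0")
    case False
    have "(x /\<^sub>R norm x) \<bullet> f (x /\<^sub>R norm x) \<le> m"
      unfolding m_def using False that by (intro max subspace_scale [OF S]) auto
    then have "(x \<bullet> f x) / (norm x)\<^sup>2 \<le> m"
      by (simp add: linear_scale [OF lin] power2_eq_square divide_inverse mult_ac)
    then show ?thesis
      using False by (simp add: q_def divide_le_eq power2_norm_eq_inner)
  qed (simp add: q_def)
  have "g \<in> S"
    unfolding g_def by (intro subspace_diff subspace_scale S v inv)
  text \<open>The nonnegative form \<open>q\<close> vanishes at \<open>v\<close>, so its first variation \<open>2 g \<bullet> u\<close> there
    is zero in every direction \<open>u \<in> S\<close>, in particular for \<open>u = g\<close>.\<close>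
  have q_line: "q (v + t *\<^sub>R g) = 2 * t * (g \<bullet> g) + t\<^sup>2 * q g" for t
  proof -
    have "q (v + t *\<^sub>R g) = (m * (v \<bullet> v) - v \<bullet> f v) + 2 * t * (m * (v \<bullet> g) - f v \<bullet> g) + t\<^sup>2 * q g"
      using selfadj [of v g]
      by (simp add: q_def linear_add [OF lin] linear_scale [OF lin] inner_add_left inner_add_right
          inner_commute power2_eq_square algebra_simps)
    moreover have "m * (v \<bullet> g) - f v \<bullet> g = g \<bullet> g"
      by (simp add: g_def inner_diff_left)
    ultimately show ?thesis
      by (simp add: m_def vv)
  qed
  have "g \<bullet> g = 0"
  proof (rule ccontr)
    assume "g \<bullet> g \<noteq> 0"
    then have pos: "0 < g \<bullet> g"
      by (simp add: inner_gt_zero_iff)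
    \<comment> \<open>The negative sign makes the linear term of \<open>q_line\<close> negative, and
      the size is small enough that the quadratic term cannot compensate. The \<open>+ 1\<close>
      keeps the denominator positive when \<open>q g = 0\<close>.\<close>
    define t where "t = - (g \<bullet> g) / (q g + 1)"
    have qg: "0 \<le> q g"
      using q_nonneg \<open>g \<in> S\<close> by blast
    have "0 \<le> q (v + t *\<^sub>R g)"
      by (intro q_nonneg subspace_add subspace_scale S v \<open>g \<in> S\<close>)
    then have "0 \<le> t * (2 * (g \<bullet> g) + t * q g)"
      unfolding q_line by (simp add: power2_eq_square algebra_simps)
    moreover have "t < 0"
      using pos qg by (simp add: t_def divide_neg_pos)
    moreover have "- t * q g \<le> g \<bullet> g"
      using pos qg by (simp add: t_def field_simps)
    ultimately show False
      using pos by (auto simp: zero_le_mult_iff)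
  qed
  then show ?thesis
    by (simp add: g_def m_def)
qed

text \<open>Induction on the dimension, stated for invariant subspaces so that it can pass to the
  orthogonal complement of an eigenvector inside \<open>S\<close>. Compactness of the unit sphere of
  \<open>S\<close> yields that eigenvector.\<close>

lemma self_adjoint_orthonormal_eigenbasis:
  fixes f :: "'a::euclidean_space \<Rightarrow> 'a"
  assumes lin: "linear f" and selfadj: "\<And>x y. f x \<bullet> y = x \<bullet> f y"
    and "subspace S" and "\<And>x. x \<in> S \<Longrightarrow> f x \<in> S"
  shows "\<exists>B. B \<subseteq> S \<and> pairwise orthogonal B \<and> (\<forall>b\<in>B. norm b = 1 \<and> f b = (b \<bullet> f b) *\<^sub>R b) \<and> span B = S"
  using assms(3,4)
proof (induction "dim S" arbitrary: S rule: less_induct)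
  case less
  note S = \<open>subspace S\<close> and inv = less.prems(2)
  show ?case
  proof (cases "S = {0}")
    case True
    then show ?thesis
      by (intro exI [of _ "{}"]) auto
  next
    case False
    then obtain z where z: "z \<in> S" "z \<noteq> 0"
      using subspace_0 [OF S] by blast
    let ?K = "S \<inter> sphere 0 1"
    have "compact ?K"
      using closed_subspace [OF S] by (simp add: closed_Int_compact)
    moreover have "z /\<^sub>R norm z \<in> ?K"
      using z by (auto intro: subspace_scale [OF S])
    moreover have "continuous_on ?K (\<lambda>x. x \<bullet> f x)"
      by (intro continuous_intros linear_continuous_on linear_conv_bounded_linear [THEN iffD1] lin)
    ultimately obtain v where "v \<in> ?K" and vmax: "\<And>x. x \<in> ?K \<Longrightarrow> x \<bullet> f x \<le> v \<bullet> f v"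
      using continuous_attains_sup [of ?K "\<lambda>x. x \<bullet> f x"] by blast
    then have v: "v \<in> S" "norm v = 1"
      by auto
    have vv: "v \<bullet> v = 1"
      using v by (simp add: norm_eq_1)
    have eig: "f v = (v \<bullet> f v) *\<^sub>R v"
      by (rule form_maximizer_is_eigenvector [OF lin selfadj S inv v]) (use vmax in auto)
    define T where "T = {x \<in> S. x \<bullet> v = 0}"
    have T: "subspace T"
      using S by (auto simp: T_def subspace_def inner_add_left)
    \<comment> \<open>Self-adjointness moves \<open>f\<close> onto the eigenvector:
      \<open>f x \<bullet> v = x \<bullet> f v\<close>, a multiple of
      \<open>x \<bullet> v = 0\<close>.\<close>
    have Tinv: "f x \<in> T" if "x \<in> T" for x
      using that inv eig selfadj [of x v] by (auto simp: T_def) (metis inner_scaleR_right mult_zero_right)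
    have "T \<subset> S"
    proof
      have "v \<notin> T"
        using vv by (simp add: T_def)
      with v show "T \<noteq> S"
        by blast
    qed (auto simp: T_def)
    then have "dim T < dim S"
      using S T dim_psubset by (metis span_eq_iff)
    then obtain B where B: "B \<subseteq> T" "pairwise orthogonal B"
        "\<forall>b\<in>B. norm b = 1 \<and> f b = (b \<bullet> f b) *\<^sub>R b" "span B = T"
      using less.hyps [OF _ T Tinv] by blast
    have "S \<subseteq> span (insert v B)"
    proof
      fix x assume "x \<in> S"
      then have "x - (x \<bullet> v) *\<^sub>R v \<in> T"
        using v vv by (auto simp: T_def inner_diff_left intro!: subspace_diff subspace_scale S)
      then show "x \<in> span (insert v B)"
        unfolding span_insert using B by blast
    qed
    moreover have "insert v B \<subseteq> S"
      using v B by (auto simp: T_def)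
    moreover have "pairwise orthogonal (insert v B)"
      using B(1,2) by (auto simp: pairwise_insert T_def orthogonal_def inner_commute)
    moreover have "span (insert v B) \<subseteq> S"
      using \<open>insert v B \<subseteq> S\<close> S by (rule span_minimal)
    ultimately show ?thesis
      using v eig B(3) by (intro exI [of _ "insert v B"]) auto
  qed
qed

text \<open>An orthonormal eigenbasis, indexed by \<open>'n\<close> through a bijection, gives the
  columns of \<open>Q\<close>; the eigenvector equations then read
  \<open>A ** Q = Q ** diagonal_matrix d\<close>.\<close>

lemma symmetric_spectral_decomposition:
  fixes A :: "real^'n^'n"
  assumes sym: "transpose A = A"
  obtains Q d where "spectral_decomposition A Q d"
proof -
  have "(A *v x) \<bullet> y = x \<bullet> (A *v y)" for x y
    by (metis dot_lmul_matrix sym transpose_matrix_vector)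
  then obtain B where B: "pairwise orthogonal B" "span B = UNIV"
      and eig: "\<And>b. b \<in> B \<Longrightarrow> norm b = 1 \<and> A *v b = (b \<bullet> (A *v b)) *\<^sub>R b"
    using self_adjoint_orthonormal_eigenbasis [of "(*v) A" UNIV] by (auto intro: matrix_vector_mul_linear)
  have "independent B"
    using B(1) eig by (intro pairwise_orthogonal_independent) force+
  then have "card B = CARD('n)" "finite B"
    using dim_eq_card [of B UNIV] B(2) by (auto simp: independent_imp_finite)
  then obtain b where b: "bij_betw b (UNIV :: 'n set) B"
    using finite_same_card_bij [of "UNIV :: 'n set" B] by auto
  then have bB: "b j \<in> B" and inj: "b i = b j \<longleftrightarrow> i = j" for i j
    by (auto simp: bij_betw_def inj_eq)
  define Q :: "real^'n^'n" where "Q = (\<chi> i j. b j $ i)"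
  define d where "d j = b j \<bullet> (A *v b j)" for j
  have col: "column j Q = b j" for j
    by (simp add: column_def Q_def vec_eq_iff)
  have Q: "orthogonal_matrix Q"
    unfolding orthogonal_matrix_orthonormal_columns col
    using bB inj B(1) eig by (auto simp: pairwise_def)
  have "A ** Q = Q ** diagonal_matrix d"
  proof -
    have "(A ** Q) $ i $ j = (Q ** diagonal_matrix d) $ i $ j" for i j
    proof -
      have "(A ** Q) $ i $ j = (A *v b j) $ i"
        by (simp add: matrix_matrix_mult_def matrix_vector_mult_def Q_def)
      also have "A *v b j = d j *\<^sub>R b j"
        using eig [OF bB] by (simp add: d_def)
      finally show ?thesis
        by (simp add: matrix_matrix_mult_def diagonal_matrix_def Q_def if_distrib cong: if_cong)
    qed
    then show ?thesis
      by (simp add: vec_eq_iff)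
  qed
  then have "A = Q ** diagonal_matrix d ** transpose Q"
    by (metis Q matrix_mul_assoc matrix_mul_rid orthogonal_matrix_def)
  then show ?thesis
    using Q that by (simp add: spectral_decomposition_def)
qed

section \<open>Eigenvalues and trace\<close>

text \<open>Kept over a general semiring, with the diagonal matrix written out, because it serves
  both real and polynomial entries.\<close>

lemma orthogonal_conj_diagonal_nth:
  fixes Q :: "'a::comm_semiring_1^'n^'n"
  shows "(Q ** (\<chi> i j. if i = j then d i else 0) ** transpose Q) $ i $ j =
    (\<Sum>k\<in>UNIV. Q $ i $ k * d k * Q $ j $ k)"
  by (simp add: matrix_matrix_mult_def transpose_def if_distrib cong: if_cong)

text \<open>The decomposition lifts to polynomial matrices: xI - A = R (xI - D) R^T, where
  \<open>R\<close> is \<open>Q\<close> with entries read as constants. Determinants are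
  multiplicative and R R^T = I.\<close>

lemma characteristic_poly_spectral:
  fixes A :: "real^'n^'n"
  assumes "spectral_decomposition A Q d"
  shows "characteristic_poly A = (\<Prod>k\<in>UNIV. [:- d k, 1:])"
proof -
  have Q: "Q ** transpose Q = mat 1" and A: "A = Q ** diagonal_matrix d ** transpose Q"
    using assms by (auto simp: spectral_decomposition_def orthogonal_matrix_def)
  define R :: "real poly^'n^'n" where "R = (\<chi> i j. [:Q $ i $ j:])"
  let ?D = "\<lambda>e :: 'n \<Rightarrow> real poly. \<chi> i j. if i = j then e i else 0"
  \<comment> \<open>The entries have degree at most one, so the matrix identities can be checked on
    two coefficients.\<close>
  have sum_linear: "(\<Sum>k\<in>K. [:g k, h k:]) = [:\<Sum>k\<in>K. g k, \<Sum>k\<in>K. h k:]"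
    for g h :: "'n \<Rightarrow> real" and K
    by (induction K rule: infinite_finite_induct) simp_all
  have QQ: "(\<Sum>k\<in>UNIV. Q $ i $ k * Q $ j $ k) = (if i = j then 1 else 0)" for i j
    using arg_cong [OF Q, of "\<lambda>B. B $ i $ j"]
    by (simp add: matrix_matrix_mult_def transpose_def mat_def)
  have Anth: "A $ i $ j = (\<Sum>k\<in>UNIV. Q $ i $ k * d k * Q $ j $ k)" for i j
    unfolding A diagonal_matrix_def orthogonal_conj_diagonal_nth ..
  have "(\<chi> i j. [:- (A $ i $ j), if i = j then 1 else 0:]) =
      R ** ?D (\<lambda>k. [:- d k, 1:]) ** transpose R"
  proof -
    have "[:- (A $ i $ j), if i = j then 1 else 0:] =
        (\<Sum>k\<in>UNIV. [:Q $ i $ k:] * [:- d k, 1:] * [:Q $ j $ k:])" for i j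
    proof -
      have "[:Q $ i $ k:] * [:- d k, 1:] * [:Q $ j $ k:] =
          [:- (Q $ i $ k * d k * Q $ j $ k), Q $ i $ k * Q $ j $ k:]" for k
        by simp
      then show ?thesis
        by (simp only: sum_linear QQ Anth sum_negf)
    qed
    then show ?thesis
      by (simp add: vec_eq_iff orthogonal_conj_diagonal_nth R_def)
  qed
  then have "characteristic_poly A = det R * (\<Prod>k\<in>UNIV. [:- d k, 1:]) * det (transpose R)"
    by (simp add: characteristic_poly_def det_mul det_diagonal)
  also have "\<dots> = (\<Prod>k\<in>UNIV. [:- d k, 1:]) * det (R ** transpose R)"
    by (simp only: det_mul mult_ac)
  also have "R ** transpose R = mat 1"
  proof -
    have "(\<Sum>k\<in>UNIV. [:Q $ i $ k:] * [:Q $ j $ k:]) = (if i = j then 1 else 0)" for i j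
      using sum_linear [of "\<lambda>k. Q $ i $ k * Q $ j $ k" "\<lambda>k. 0" UNIV]
      by (simp add: QQ mult.commute split: if_split_asm)
    then show ?thesis
      by (simp add: R_def vec_eq_iff matrix_matrix_mult_def transpose_def mat_def)
  qed
  finally show ?thesis
    by simp
qed

lemma eigenvalues_spectral:
  fixes A :: "real^'n^'n"
  assumes "spectral_decomposition A Q d"
  shows "eigenvalues A = image_mset d (mset_set UNIV)"
proof -
  have "proots (\<Prod>k\<in>K. [:- d k, 1:]) = image_mset d (mset_set K)" if "finite K" for K :: "'n set"
    using that by (subst proots_prod) (auto simp: sum_unfold_sum_mset)
  then show ?thesis
    by (simp add: eigenvalues_def characteristic_poly_spectral [OF assms])
qed

lemma trace_spectral:
  fixes Q :: "real^'n^'n"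
  assumes "orthogonal_matrix Q"
  shows "trace (Q ** diagonal_matrix d ** transpose Q) = (\<Sum>k\<in>UNIV. d k)"
proof -
  have "trace (Q ** diagonal_matrix d ** transpose Q) =
      trace ((transpose Q ** Q) ** diagonal_matrix d)"
    by (metis trace_mul_sym matrix_mul_assoc)
  then show ?thesis
    using assms by (simp add: orthogonal_matrix_def trace_def diagonal_matrix_def)
qed

text \<open>Links the norm, defined by roots of the characteristic polynomial, to the trace, which
  is the mean of the Gaussian form.\<close>

lemma schatten_norm_eq_trace:
  fixes A :: "real^'n^'n"
  assumes "transpose A = A"
  shows "schatten_norm p A = trace (matrix_powr A p) powr (1 / p)"
proof -
  obtain Q d where Qd: "spectral_decomposition A Q d"
    using symmetric_spectral_decomposition [OF assms] .
  then have "orthogonal_matrix Q"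
    by (simp add: spectral_decomposition_def)
  then show ?thesis
    by (simp add: schatten_norm_def eigenvalues_spectral [OF Qd] matrix_powr_eq [OF Qd]
        trace_spectral image_mset.compositionality o_def flip: sum_unfold_sum_mset)
qed

text \<open>In the coordinates \<open>transpose Q *v x\<close> the form is a sum of squares with
  weights \<open>d i powr p\<close>, and \<open>powr\<close> is never negative.\<close>

lemma matrix_powr_form_nonneg:
  fixes A :: "real^'n^'n"
  assumes "transpose A = A"
  shows "0 \<le> x \<bullet> (matrix_powr A p *v x)"
proof -
  obtain Q d where Qd: "spectral_decomposition A Q d"
    using symmetric_spectral_decomposition [OF assms] .
  define y where "y = transpose Q *v x"
  have "x \<bullet> (matrix_powr A p *v x) = y \<bullet> (diagonal_matrix (\<lambda>i. d i powr p) *v y)"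
    unfolding matrix_powr_eq [OF Qd] y_def
    by (simp add: transpose_matrix_vector flip: matrix_vector_mul_assoc dot_lmul_matrix)
  also have "\<dots> = (\<Sum>i\<in>UNIV. d i powr p * (y $ i)\<^sup>2)"
  proof -
    have "(diagonal_matrix e *v y) $ i = e i * y $ i" for e i
      by (simp add: matrix_vector_mult_def diagonal_matrix_def if_distrib [of "\<lambda>z. z * _"] cong: if_cong)
    then show ?thesis
      by (simp add: inner_vec_def power2_eq_square mult_ac)
  qed
  also have "0 \<le> \<dots>"
    by (intro sum_nonneg) simp
  finally show ?thesis .
qed

section \<open>Gaussian quadratic forms and Jensen's inequality\<close>

context prob_space
begin

unbundle no fps_syntax

text \<open>Restrictions of the family to the disjoint index sets \<open>{i}\<close> and
  \<open>{j}\<close> are independent; evaluation recovers the two variables.\<close>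

lemma indep_vars_imp_indep_var:
  assumes "indep_vars N X I" and "i \<in> I" "j \<in> I" "i \<noteq> j"
  shows "indep_var (N i) (X i) (N j) (X j)"
proof -
  have "indep_var (N i) ((\<lambda>f. f i) \<circ> (\<lambda>\<omega>. restrict (\<lambda>k. X k \<omega>) {i}))
      (N j) ((\<lambda>f. f j) \<circ> (\<lambda>\<omega>. restrict (\<lambda>k. X k \<omega>) {j}))"
    using assms by (intro indep_var_compose [OF indep_var_restrict [OF assms(1)]]) auto
  then show ?thesis
    by (simp add: o_def)
qed

lemma standard_gaussian_second_moments:
  fixes w :: "'a \<Rightarrow> real^'n"
  assumes "standard_gaussian_vector w"
  shows "integrable M (\<lambda>\<omega>. w \<omega> $ i * w \<omega> $ j)"
    and "expectation (\<lambda>\<omega>. w \<omega> $ i * w \<omega> $ j) = (if i = j then 1 else 0)"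
proof -
  have ind: "indep_vars (\<lambda>_. borel) (\<lambda>i \<omega>. w \<omega> $ i) UNIV"
    and dist: "distributed M lborel (\<lambda>\<omega>. w \<omega> $ k) std_normal_density" for k
    using assms by (auto simp: standard_gaussian_vector_def)
  have int: "integrable M (\<lambda>\<omega>. w \<omega> $ k)" for k
    using distributed_integrable [OF dist, of "\<lambda>x. x" k] integrable_std_normal_moment [of 1] by simp
  have "integrable M (\<lambda>\<omega>. w \<omega> $ i * w \<omega> $ j) \<and>
      expectation (\<lambda>\<omega>. w \<omega> $ i * w \<omega> $ j) = (if i = j then 1 else 0)"
  proof (cases "i = j")
    case True
    then show ?thesis
      \<comment> \<open>The even-moment formula at 1 gives the variance 2! / (2 * 1!) = 1.\<close>
      using distributed_integrable [OF dist, of "\<lambda>x. x\<^sup>2" j] integrable_std_normal_moment [of 2]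
        distributed_integral [OF dist, of "\<lambda>x. x\<^sup>2" j] integral_std_normal_moment_even [of 1]
      by (simp add: power2_eq_square)
  next
    case False
    have "indep_var borel (\<lambda>\<omega>. w \<omega> $ i) borel (\<lambda>\<omega>. w \<omega> $ j)"
      using indep_vars_imp_indep_var [OF ind _ _ False] by simp
    then show ?thesis
      using False indep_var_integrable [OF _ int int] indep_var_lebesgue_integral [OF _ int int]
        standard_normal_distributed_expectation [OF dist] by simp
  qed
  then show "integrable M (\<lambda>\<omega>. w \<omega> $ i * w \<omega> $ j)"
    and "expectation (\<lambda>\<omega>. w \<omega> $ i * w \<omega> $ j) = (if i = j then 1 else 0)"
    by auto
qed

text \<open>By linearity the off-diagonal terms average to zero and each diagonal entry is
  multiplied by a unit variance.\<close>

lemma standard_gaussian_quadratic_form: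
  fixes w :: "'a \<Rightarrow> real^'n" and B :: "real^'n^'n"
  assumes "standard_gaussian_vector w"
  shows "integrable M (\<lambda>\<omega>. w \<omega> \<bullet> (B *v w \<omega>))"
    and "expectation (\<lambda>\<omega>. w \<omega> \<bullet> (B *v w \<omega>)) = trace B"
proof -
  have form: "w \<omega> \<bullet> (B *v w \<omega>) = (\<Sum>i\<in>UNIV. \<Sum>j\<in>UNIV. B $ i $ j * (w \<omega> $ i * w \<omega> $ j))" for \<omega>
    by (simp add: inner_vec_def matrix_vector_mult_def sum_distrib_left mult_ac)
  note moments = standard_gaussian_second_moments [OF assms]
  show "integrable M (\<lambda>\<omega>. w \<omega> \<bullet> (B *v w \<omega>))"
    unfolding form by (intro Bochner_Integration.integrable_sum integrable_mult_right moments)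
  show "expectation (\<lambda>\<omega>. w \<omega> \<bullet> (B *v w \<omega>)) = trace B"
    unfolding form by (simp add: moments trace_def if_distrib cong: if_cong)
qed

lemma jensen_powr_inverse:
  fixes Y :: "'a \<Rightarrow> real"
  assumes p: "1 \<le> p" and Y: "integrable M Y" and nonneg: "\<And>\<omega>. 0 \<le> Y \<omega>"
  shows "integrable M (\<lambda>\<omega>. Y \<omega> powr (1 / p))"
    and "expectation (\<lambda>\<omega>. Y \<omega> powr (1 / p)) \<le> expectation Y powr (1 / p)"
proof -
  text \<open>The tangent line at \<open>c\<close> of the concave function \<open>x powr (1 / p)\<close>.\<close>
  have tangent: "y powr (1 / p) \<le> c powr (1 / p) * (y / (p * c) + (1 - 1 / p))"
    if "0 \<le> y" "0 < c" for y c :: real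
  proof (cases "y = 0")
    case False
    \<comment> \<open>Weighted AM-GM for \<open>y / c\<close> and 1; multiplying by
      \<open>c powr (1 / p)\<close> gives the tangent bound.\<close>
    have "(y / c) powr (1 / p) * 1 powr (1 - 1 / p) \<le> 1 / p * (y / c) + (1 - 1 / p) * 1"
      using p that False by (intro Youngs_inequality_0) (auto simp: field_simps)
    then show ?thesis
      using that p by (simp add: powr_divide field_simps)
  qed (use p that in \<open>simp add: field_simps\<close>)
  have [measurable]: "Y \<in> borel_measurable M"
    using Y by simp
  show int: "integrable M (\<lambda>\<omega>. Y \<omega> powr (1 / p))"
  proof (rule Bochner_Integration.integrable_bound)
    show "integrable M (\<lambda>\<omega>. Y \<omega> / p + (1 - 1 / p))"
      using Y by simp
    \<comment> \<open>The tangent at 1 is an integrable majorant.\<close>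
    show "AE \<omega> in M. norm (Y \<omega> powr (1 / p)) \<le> norm (Y \<omega> / p + (1 - 1 / p))"
      using tangent [OF nonneg, of 1] by (intro AE_I2) (force intro: order_trans [OF _ abs_ge_self])
  qed measurable
  define m where "m = expectation Y"
  have "0 \<le> m"
    using nonneg by (simp add: m_def)
  show "expectation (\<lambda>\<omega>. Y \<omega> powr (1 / p)) \<le> expectation Y powr (1 / p)"
  proof (cases "m = 0")
    case True
    \<comment> \<open>There is no tangent at 0, but a nonnegative variable of mean zero vanishes
      almost everywhere.\<close>
    then have "AE \<omega> in M. Y \<omega> = 0"
      using integral_nonneg_eq_0_iff_AE [OF Y] nonneg by (simp add: m_def)
    then have "expectation (\<lambda>\<omega>. Y \<omega> powr (1 / p)) = expectation (\<lambda>\<omega>. 0)"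
      by (intro integral_cong_AE) auto
    then show ?thesis
      by simp
  next
    case False
    with \<open>0 \<le> m\<close> have "0 < m"
      by simp
    have "expectation (\<lambda>\<omega>. Y \<omega> powr (1 / p)) \<le>
        expectation (\<lambda>\<omega>. m powr (1 / p) * (Y \<omega> / (p * m) + (1 - 1 / p)))"
      using tangent [OF nonneg \<open>0 < m\<close>] by (intro integral_mono int) (use Y in auto)
    \<comment> \<open>With the tangent taken at the mean, the bracket averages to 1 / p + (1 - 1 /
      p) = 1.\<close>
    also have "\<dots> = m powr (1 / p) * (m / (p * m) + (1 - 1 / p))"
      using Y by (simp add: m_def prob_space)
    also have "\<dots> = m powr (1 / p)"
      using p \<open>0 < m\<close> by simp
    finally show ?thesis
      by (simp add: m_def)
  qed
qed

end

theorem proposition2: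
  fixes P :: "'a measure" and A :: "real^'n^'n" and p :: real
    and M :: nat and w :: "nat \<Rightarrow> 'a \<Rightarrow> real^'n"
  assumes "prob_space P"
    and "positive_semidefinite A"
    and "p \<ge> 1"
    and "M \<ge> 1"
    and "prob_space.indep_vars P (\<lambda>_. borel) w {1..M}"
    and "\<And>j. j \<in> {1..M} \<Longrightarrow> prob_space.standard_gaussian_vector P (w j)"
  shows "integrable P (schatten_estimator p A w M) \<and>
    prob_space.expectation P (schatten_estimator p A w M) \<le> schatten_norm p A"
proof -
  interpret prob_space P by fact
  have sym: "transpose A = A"
    using assms(2) by (simp add: positive_semidefinite_def)
  define Y where "Y \<omega> = 1 / real M * (\<Sum>j=1..M. w j \<omega> \<bullet> (matrix_powr A p *v w j \<omega>))" for \<omega>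
  note form = standard_gaussian_quadratic_form [OF assms(6), of _ "matrix_powr A p"]
  have int: "integrable P Y"
    unfolding Y_def by (intro integrable_mult_right Bochner_Integration.integrable_sum form)
  have nonneg: "0 \<le> Y \<omega>" for \<omega>
    unfolding Y_def by (intro mult_nonneg_nonneg sum_nonneg matrix_powr_form_nonneg sym) simp
  have "expectation Y = 1 / real M * (\<Sum>j=1..M. trace (matrix_powr A p))"
    unfolding Y_def using form by (subst integral_mult_right_zero) (simp add: Bochner_Integration.integral_sum)
  \<comment> \<open>\<open>M \<ge> 1\<close> lets the factor \<open>1 / real M\<close> cancel the
    \<open>M\<close> equal summands.\<close>
  then have "expectation Y = trace (matrix_powr A p)"
    using \<open>M \<ge> 1\<close> by simp
  moreover have "schatten_estimator p A w M = (\<lambda>\<omega>. Y \<omega> powr (1 / p))"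
    by (simp add: fun_eq_iff schatten_estimator_def Y_def)
  ultimately show ?thesis
    using jensen_powr_inverse [OF \<open>p \<ge> 1\<close> int nonneg] by (simp add: schatten_norm_eq_trace [OF sym])
qed

end
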